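(* Let $A$ be an $n\times n$ Hermitian matrix of rank $r\le n$ with eigenvalues ordered so that $\lambda_1\ge\dots\ge\lambda_r$ are its nonzero eigenvalues and $\lambda_{r+1}=\dots=\lambda_n=0$. Let $E$ be an $n\times n$ Hermitian matrix, and let the eigenvalues of $A+E$ be arranged in decreasing order, $\lambda_1(A+E)\ge\dots\ge\lambda_n(A+E)$. If $k=\|(A^{1/2})^{+}E(A^{1/2})^{+}\|\le 1$, then for every $i\in\{1,\dots,r\}$, $$\lambda_{n-r+i}(A+E)\le \lambda_i+k|\lambda_i|\qquad\text{and}\qquad \lambda_i(A+E)\ge \lambda_i-k|\lambda_i|.$$
   Context: All matrices are complex. $\|\cdot\|$ is the matrix 2-norm (largest singular value), $X^{*}$ the conjugate transpose, and $X^{+}$ the Moore-Penrose pseudo-inverse. For a normal matrix $A=VDV^{*}$ with $V$ unitary and $D=\mathrm{diag}(\lambda_1,\dots,\lambda_n)$, $A^{1/2}$ denotes any normal square root $A^{1/2}=V\,\mathrm{diag}(\lambda_1^{1/2},\dots,\lambda_n^{1/2})V^{*}$, where $\lambda_j^{1/2}$ is a (possibly complex) square root of $\lambda_j$; thus $(A^{1/2})^2=A$. Eigenvalues are counted with multiplicity. *)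

theory Defs
  imports
    "Jordan_Normal_Form.Char_Poly"
    "Jordan_Normal_Form.Schur_Decomposition"
    "Jordan_Normal_Form.DL_Rank"
begin

definition hermitian_mat :: "complex mat \<Rightarrow> bool" where
  "hermitian_mat A \<longleftrightarrow> mat_adjoint A = A"

definition unitary_mat :: "nat \<Rightarrow> complex mat \<Rightarrow> bool" where
  "unitary_mat n V \<longleftrightarrow> V \<in> carrier_mat n n \<and>
     mat_adjoint V * V = 1\<^sub>m n \<and> V * mat_adjoint V = 1\<^sub>m n"

(* The roots s j are chosen index by index, so equal eigenvalues may receive different roots. *)
definition normal_sqrt :: "nat \<Rightarrow> complex mat \<Rightarrow> complex mat \<Rightarrow> bool" where
  "normal_sqrt n A S \<longleftrightarrow> (\<exists>V d s. unitary_mat n V \<and>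
     A = V * mat_diag n d * mat_adjoint V \<and>
     S = V * mat_diag n s * mat_adjoint V \<and>
     (\<forall>j<n. (s j)\<^sup>2 = d j))"

(* The four Penrose conditions. *)
definition moore_penrose :: "complex mat \<Rightarrow> complex mat \<Rightarrow> bool" where
  "moore_penrose X Y \<longleftrightarrow> Y \<in> carrier_mat (dim_col X) (dim_row X) \<and>
     X * Y * X = X \<and> Y * X * Y = Y \<and>
     hermitian_mat (X * Y) \<and> hermitian_mat (Y * X)"

(* Every complex matrix has exactly one Moore-Penrose inverse, so THE is well defined. *)
definition pinv :: "complex mat \<Rightarrow> complex mat" where
  "pinv X = (THE Y. moore_penrose X Y)"

definition singular_values :: "complex mat \<Rightarrow> real set" where
  "singular_values X =
     {\<sigma>. \<sigma> \<ge> 0 \<and> eigenvalue (mat_adjoint X * X) (complex_of_real (\<sigma>\<^sup>2))}"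

(* For square X this is the matrix 2-norm; the set is finite, and nonempty unless dim_col X = 0. *)
definition norm2_mat :: "complex mat \<Rightarrow> real" where
  "norm2_mat X = Max (singular_values X)"

(* ev 1, ..., ev n lists the eigenvalues of M with algebraic multiplicity (in any order). *)
definition eigenvalue_list :: "nat \<Rightarrow> complex mat \<Rightarrow> (nat \<Rightarrow> real) \<Rightarrow> bool" where
  "eigenvalue_list n M ev \<longleftrightarrow>
     char_poly M = (\<Prod>i=1..n. [:- complex_of_real (ev i), 1:])"

end

theory Submission
  imports Defs "HOL-Analysis.L2_Norm"
begin

text \<open>
In a unitary eigenbasis of \<^term>\<open>A\<close> with eigenvalues \<open>d j\<close>, write \<open>w j\<close> for the coordinates of a
vector \<open>x\<close>. For \<open>x\<close> in the range of \<^term>\<open>A\<close> the square root and its pseudo-inverse cancel, so the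
form of \<^term>\<open>E\<close> at \<open>x\<close> is a pairing through \<open>(A\<^sup>1\<^sup>/\<^sup>2)\<^sup>+ E (A\<^sup>1\<^sup>/\<^sup>2)\<^sup>+\<close> of two vectors whose squared
length is the sum of \<open>|d j| |w j|\<^sup>2\<close>. By Cauchy-Schwarz it is at most \<open>k\<close> times that
sum (\<open>quadratic_form_le_norm2\<close>). On the range of \<^term>\<open>A\<close> the form of \<^term>\<open>A + E\<close> therefore lies between the
diagonal forms with entries \<open>d j - k |d j|\<close> and \<open>d j + k |d j|\<close>
(\<open>relative_perturbation_quadratic_form\<close>).

Eigenvalues follow by counting dimensions (\<open>quadratic_form_comparison\<close>). The eigenvectors of
\<^term>\<open>A\<close> with nonzero eigenvalue at least \<open>\<lambda>\<^sub>i\<close> span a space of dimension at least \<open>i\<close> inside the range.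
Because \<open>k \<le> 1\<close>, the map \<open>t \<mapsto> t - k |t|\<close> is monotone, so the form of \<^term>\<open>A + E\<close> is there at
least \<open>\<lambda>\<^sub>i - k |\<lambda>\<^sub>i|\<close> times the squared norm. This space meets the span of the last \<open>n - i + 1\<close>
eigenvectors of \<^term>\<open>A + E\<close>, where the form is at most its \<open>i\<close>-th eigenvalue times the squared norm.
This is the lower bound. The upper bound pairs the space of nonzero eigenvalues at most \<open>\<lambda>\<^sub>i\<close>, of
dimension at least \<open>r - i + 1\<close>, with the first \<open>n - r + i\<close> eigenvectors of \<^term>\<open>A + E\<close>. Staying
inside the range of \<^term>\<open>A\<close> costs \<open>n - r\<close> dimensions, which is the source of the index shift.

The ordered eigenvectors of \<^term>\<open>A + E\<close> come from the spectral theorem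
(\<open>hermitian_unitary_diagonalization\<close>), which also shows that the largest singular value bounds
the growth of vector norms (\<open>norm2_mat_bound\<close>).
\<close>

section \<open>Adjoints, the Euclidean norm and unitary matrices\<close>

lemma mat_adjoint_dim [simp]:
  "dim_row (mat_adjoint A) = dim_col A" "dim_col (mat_adjoint A) = dim_row A"
  by (simp_all add: mat_adjoint_def)

lemma mat_adjoint_carrier [simp]: "A \<in> carrier_mat m n \<Longrightarrow> mat_adjoint A \<in> carrier_mat n m"
  by (auto intro!: carrier_matI)

lemma mat_adjoint_index [simp]:
  "i < dim_col A \<Longrightarrow> j < dim_row A \<Longrightarrow> mat_adjoint A $$ (i, j) = conjugate (A $$ (j, i))"
  by (simp add: mat_adjoint_def mat_of_rows_index)

lemma mat_adjoint_adjoint [simp]: "mat_adjoint (mat_adjoint A) = A"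
  by (rule eq_matI) auto

lemma mat_adjoint_mult:
  assumes "A \<in> carrier_mat m p" "B \<in> carrier_mat p n"
  shows "mat_adjoint (A * B) = mat_adjoint B * mat_adjoint A"
  by (rule eq_matI)
    (use assms in \<open>auto simp: scalar_prod_def sum_conjugate conjugate_dist_mul mult.commute
      intro!: sum.cong\<close>)

lemma mat_adjoint_diag [simp]: "mat_adjoint (mat_diag n f) = mat_diag n (\<lambda>i. conjugate (f i))"
  by (rule eq_matI) (auto simp: mat_diag_def)

lemma cscalar_prod_adjoint:
  assumes "A \<in> carrier_mat m n" "x \<in> carrier_vec n" "y \<in> carrier_vec m"
  shows "(A *\<^sub>v x) \<bullet>c y = x \<bullet>c (mat_adjoint A *\<^sub>v y)"
proof -
  have "(A *\<^sub>v x) \<bullet>c y = (\<Sum>i<m. \<Sum>j<n. A $$ (i, j) * x $ j * conjugate (y $ i))"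
    using assms by (simp add: scalar_prod_def sum_distrib_right lessThan_atLeast0)
  also have "\<dots> = (\<Sum>j<n. \<Sum>i<m. A $$ (i, j) * x $ j * conjugate (y $ i))"
    by (rule sum.swap)
  also have "\<dots> = x \<bullet>c (mat_adjoint A *\<^sub>v y)"
    using assms
    by (simp add: scalar_prod_def sum_distrib_left lessThan_atLeast0 sum_conjugate
        conjugate_dist_mul mult.assoc mult.left_commute)
  finally show ?thesis .
qed

definition sqnorm :: "complex vec \<Rightarrow> real" where
  "sqnorm x = (\<Sum>i<dim_vec x. (cmod (x $ i))\<^sup>2)"

lemma sqnorm_nonneg [simp]: "sqnorm x \<ge> 0"
  by (simp add: sqnorm_def sum_nonneg)

lemma cscalar_prod_self: "x \<bullet>c x = of_real (sqnorm x)" for x :: "complex vec"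
  by (simp add: sqnorm_def scalar_prod_def lessThan_atLeast0 complex_norm_square del: of_real_power)

lemma sqnorm_pos:
  assumes "x \<in> carrier_vec n" "x \<noteq> 0\<^sub>v n"
  shows "sqnorm x > 0"
  using conjugate_square_greater_0_vec[OF assms(1)] assms(2)
  by (simp add: cscalar_prod_self less_complex_def)

lemma cmod_cscalar_prod_le:
  fixes x y :: "complex vec"
  assumes "x \<in> carrier_vec n" "y \<in> carrier_vec n"
  shows "cmod (x \<bullet>c y) \<le> sqrt (sqnorm x) * sqrt (sqnorm y)"
proof -
  have "cmod (x \<bullet>c y) \<le> (\<Sum>i<n. \<bar>cmod (x $ i)\<bar> * \<bar>cmod (y $ i)\<bar>)"
    using assms unfolding scalar_prod_def
    by (auto simp: lessThan_atLeast0 norm_mult intro!: sum_norm_le)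
  also have "\<dots> \<le> L2_set (\<lambda>i. cmod (x $ i)) {..<n} * L2_set (\<lambda>i. cmod (y $ i)) {..<n}"
    by (rule L2_set_mult_ineq)
  finally show ?thesis
    using assms by (simp add: L2_set_def sqnorm_def)
qed

lemma unitary_matD:
  assumes "unitary_mat n V"
  shows "V \<in> carrier_mat n n" "mat_adjoint V \<in> carrier_mat n n"
    "mat_adjoint V * V = 1\<^sub>m n" "V * mat_adjoint V = 1\<^sub>m n"
  using assms by (auto simp: unitary_mat_def)

lemma unitary_mat_mult:
  assumes "unitary_mat n U" "unitary_mat n V"
  shows "unitary_mat n (U * V)"
proof -
  note U = unitary_matD[OF assms(1)] and V = unitary_matD[OF assms(2)]
  have "mat_adjoint (U * V) * (U * V) = mat_adjoint V * ((mat_adjoint U * U) * V)"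
    using U(1,2) V(1,2) by (simp add: mat_adjoint_mult[OF U(1) V(1)] assoc_mult_mat[of _ n n _ n _ n]
        mult_carrier_mat[of _ n n _ n])
  moreover have "U * V * mat_adjoint (U * V) = U * ((V * mat_adjoint V) * mat_adjoint U)"
    using U(1,2) V(1,2) by (simp add: mat_adjoint_mult[OF U(1) V(1)] assoc_mult_mat[of _ n n _ n _ n]
        mult_carrier_mat[of _ n n _ n])
  ultimately show ?thesis
    using U V by (simp add: unitary_mat_def)
qed

lemma unitary_mult_cancel:
  assumes "unitary_mat n V" "X \<in> carrier_mat n n"
  shows "mat_adjoint V * (V * X) = X" "V * (mat_adjoint V * X) = X"
  using unitary_matD[OF assms(1)] assms(2)
  by (simp_all flip: assoc_mult_mat[of _ n n _ n _ n])

lemma sqnorm_adjoint_unitary: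
  assumes V: "unitary_mat n V" and x: "x \<in> carrier_vec n"
  shows "sqnorm (mat_adjoint V *\<^sub>v x) = sqnorm x"
proof -
  note VD = unitary_matD[OF V]
  have "complex_of_real (sqnorm (mat_adjoint V *\<^sub>v x)) = x \<bullet>c (V *\<^sub>v (mat_adjoint V *\<^sub>v x))"
    using cscalar_prod_adjoint[OF VD(2) x] VD(2) x by (simp flip: cscalar_prod_self)
  also have "V *\<^sub>v (mat_adjoint V *\<^sub>v x) = x"
    using VD x by (simp flip: assoc_mult_mat_vec[of _ n n _ n])
  finally show ?thesis
    by (simp add: cscalar_prod_self)
qed

lemma mat_diag_mult_vec:
  assumes "w \<in> carrier_vec n"
  shows "mat_diag n f *\<^sub>v w = vec n (\<lambda>j. f j * w $ j)"
proof (rule eq_vecI)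
  fix i assume "i < dim_vec (vec n (\<lambda>j. f j * w $ j))"
  then have i: "i < n" by simp
  have "(mat_diag n f *\<^sub>v w) $ i = (\<Sum>j<n. (if i = j then f j else 0) * w $ j)"
    using assms i by (simp add: mat_diag_def scalar_prod_def lessThan_atLeast0)
  also have "\<dots> = (\<Sum>j<n. if j = i then f i * w $ i else 0)"
    by (rule sum.cong) auto
  finally show "(mat_diag n f *\<^sub>v w) $ i = vec n (\<lambda>j. f j * w $ j) $ i"
    using i by simp
qed (simp add: mat_diag_def)

lemma adjoint_unitary_conj_mult_vec:
  assumes V: "unitary_mat n V" and x: "x \<in> carrier_vec n"
  shows "mat_adjoint V *\<^sub>v (V * mat_diag n f * mat_adjoint V *\<^sub>v x) =
    vec n (\<lambda>j. f j * (mat_adjoint V *\<^sub>v x) $ j)"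
proof -
  note VD = unitary_matD[OF V]
  have "mat_adjoint V *\<^sub>v (V * mat_diag n f * mat_adjoint V *\<^sub>v x) =
      (mat_adjoint V * (V * (mat_diag n f * mat_adjoint V))) *\<^sub>v x"
    using VD(1,2) x mat_diag_dim[of n f]
    by (simp add: assoc_mult_mat[of _ n n _ n _ n] assoc_mult_mat_vec[of _ n n _ n]
        mult_carrier_mat[of _ n n _ n])
  also have "\<dots> = mat_diag n f *\<^sub>v (mat_adjoint V *\<^sub>v x)"
    using VD(1,2) x mat_diag_dim[of n f]
    by (simp add: unitary_mult_cancel[OF V] mult_carrier_mat[of _ n n] assoc_mult_mat_vec[of _ n n _ n])
  finally show ?thesis
    using VD(2) x by (simp add: mat_diag_mult_vec)
qed

text \<open>
In the coordinates \<^term>\<open>mat_adjoint V *\<^sub>v x\<close> a matrix \<^term>\<open>V * mat_diag n f * mat_adjoint V\<close>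
acts entrywise, so its norms and quadratic form become weighted sums of squared moduli. All
estimates below are comparisons of such sums.
\<close>

lemma sqnorm_unitary_conj:
  assumes V: "unitary_mat n V" and x: "x \<in> carrier_vec n"
  shows "sqnorm (V * mat_diag n f * mat_adjoint V *\<^sub>v x) =
    (\<Sum>j<n. (cmod (f j))\<^sup>2 * (cmod ((mat_adjoint V *\<^sub>v x) $ j))\<^sup>2)"
proof -
  have "V * mat_diag n f * mat_adjoint V *\<^sub>v x \<in> carrier_vec n"
    using unitary_matD[OF V] x by (auto intro!: mult_mat_vec_carrier[of _ n n] mult_carrier_mat[of _ n n])
  then have "sqnorm (V * mat_diag n f * mat_adjoint V *\<^sub>v x) =
      sqnorm (mat_adjoint V *\<^sub>v (V * mat_diag n f * mat_adjoint V *\<^sub>v x))"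
    by (simp add: sqnorm_adjoint_unitary[OF V])
  then show ?thesis
    by (simp only: adjoint_unitary_conj_mult_vec[OF assms])
      (simp add: sqnorm_def norm_mult power_mult_distrib)
qed

lemma quadratic_form_unitary_conj:
  assumes V: "unitary_mat n V" and x: "x \<in> carrier_vec n"
  shows "(V * mat_diag n f * mat_adjoint V *\<^sub>v x) \<bullet>c x =
    (\<Sum>j<n. f j * of_real ((cmod ((mat_adjoint V *\<^sub>v x) $ j))\<^sup>2))"
proof -
  note VD = unitary_matD[OF V]
  define M where "M = V * mat_diag n f * mat_adjoint V"
  have Mx: "M *\<^sub>v x \<in> carrier_vec n"
    using VD x unfolding M_def by (auto intro!: mult_mat_vec_carrier[of _ n n] mult_carrier_mat[of _ n n])
  have "x = V *\<^sub>v (mat_adjoint V *\<^sub>v x)"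
    using VD x by (simp flip: assoc_mult_mat_vec[of _ n n _ n])
  then have "(M *\<^sub>v x) \<bullet>c x = (M *\<^sub>v x) \<bullet>c (V *\<^sub>v (mat_adjoint V *\<^sub>v x))"
    by simp
  also have "\<dots> = (mat_adjoint V *\<^sub>v (M *\<^sub>v x)) \<bullet>c (mat_adjoint V *\<^sub>v x)"
    using cscalar_prod_adjoint[OF VD(2) Mx, of "mat_adjoint V *\<^sub>v x"] VD x by simp
  also have "\<dots> = (\<Sum>j<n. f j * ((mat_adjoint V *\<^sub>v x) $ j * conjugate ((mat_adjoint V *\<^sub>v x) $ j)))"
    unfolding M_def adjoint_unitary_conj_mult_vec[OF V x]
    using VD by (simp add: scalar_prod_def lessThan_atLeast0 mult.assoc)
  finally show ?thesis
    by (simp add: M_def complex_norm_square del: of_real_power)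
qed

section \<open>The spectral theorem with a prescribed order of eigenvalues\<close>

text \<open>
Gram-Schmidt starting from a basis that begins with \<^term>\<open>v\<close> yields pairwise orthogonal columns;
they have to be scaled to length one, which is where the factor \<^term>\<open>c\<close> comes from.
\<close>

lemma unitary_with_first_column:
  assumes v: "(v :: complex vec) \<in> carrier_vec n" "v \<noteq> 0\<^sub>v n"
  obtains U c where "unitary_mat n U" "col U 0 = c \<cdot>\<^sub>v v"
proof -
  interpret cof_vec_space n "TYPE(complex)" .
  have n: "n > 0" using v by (cases n) auto
  define b where "b = basis_completion v"
  define ws where "ws = gram_schmidt n b"
  note bc = basis_completion[OF v, folded b_def]
  obtain vs where "b = v # vs"
    using bc(6,7) n by (cases b) auto
  then have hd_ws: "hd ws = v"
    using gram_schmidt_hd[OF v(1), of vs] by (simp add: ws_def)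
  from gram_schmidt_result[OF bc(2) bc(4) bc(5) refl, folded ws_def]
  have ws: "set ws \<subseteq> carrier_vec n" "corthogonal ws" "length ws = n"
    by (auto simp: bc(6))
  define c where "c j = complex_of_real (1 / sqrt (sqnorm (ws ! j)))" for j
  define U where "U = mat_of_cols n (map (\<lambda>j. c j \<cdot>\<^sub>v ws ! j) [0..<n])"
  have U: "U \<in> carrier_mat n n"
    unfolding U_def by (rule carrier_matI) auto
  have wsc: "ws ! j \<in> carrier_vec n" if "j < n" for j
    using ws that by auto
  have colU: "col U j = c j \<cdot>\<^sub>v ws ! j" if "j < n" for j
    using that wsc[OF that] by (simp add: U_def)
  have "mat_adjoint U * U = 1\<^sub>m n"
  proof (rule eq_matI)
    fix i j assume ij: "i < dim_row (1\<^sub>m n :: complex mat)" "j < dim_col (1\<^sub>m n :: complex mat)"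
    have "(mat_adjoint U * U) $$ (i, j) = col U j \<bullet>c col U i"
      using ij U by (auto simp: scalar_prod_def mult.commute intro!: sum.cong)
    also have "\<dots> = c j * c i * (ws ! j \<bullet>c ws ! i)"
      using ij wsc by (simp add: colU conjugate_smult_vec c_def
          smult_scalar_prod_distrib[of _ n] scalar_prod_smult_distrib[of _ n])
    also have "\<dots> = (if i = j then 1 else 0)"
    proof (cases "i = j")
      case True
      have "ws ! i \<bullet>c ws ! i \<noteq> 0"
        using corthogonalD[OF ws(2)] ij ws(3) by auto
      then have "sqnorm (ws ! i) > 0"
        using sqnorm_nonneg[of "ws ! i"] by (simp add: cscalar_prod_self less_le del: sqnorm_nonneg)
      then show ?thesis
        using True by (simp add: c_def cscalar_prod_self flip: of_real_mult)
    next
      case False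
      then show ?thesis
        using corthogonalD[OF ws(2), of j i] ij ws(3) by auto
    qed
    finally show "(mat_adjoint U * U) $$ (i, j) = 1\<^sub>m n $$ (i, j)"
      using ij by simp
  qed (use U in auto)
  moreover from this have "U * mat_adjoint U = 1\<^sub>m n"
    using mat_mult_left_right_inverse[OF mat_adjoint_carrier[OF U] U] by simp
  ultimately have "unitary_mat n U"
    using U by (simp add: unitary_mat_def)
  moreover have "col U 0 = c 0 \<cdot>\<^sub>v v"
    using colU[of 0] n ws hd_ws by (cases ws) auto
  ultimately show ?thesis
    using that by blast
qed

text \<open>
The block diagonal matrix with blocks \<^term>\<open>a\<close> and \<^term>\<open>X\<close>. Taking the first block to be a
number makes products and adjoints of such matrices computable by rewriting.
\<close>

definition scalar_direct_sum :: "complex \<Rightarrow> complex mat \<Rightarrow> complex mat" where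
  "scalar_direct_sum a X = four_block_mat (mat 1 1 (\<lambda>_. a)) (0\<^sub>m 1 (dim_col X)) (0\<^sub>m (dim_row X) 1) X"

lemma scalar_direct_sum_carrier: "X \<in> carrier_mat m m \<Longrightarrow> scalar_direct_sum a X \<in> carrier_mat (Suc m) (Suc m)"
  by (auto simp: scalar_direct_sum_def)

lemma scalar_direct_sum_mult:
  assumes "X \<in> carrier_mat m m" "Y \<in> carrier_mat m m"
  shows "scalar_direct_sum a X * scalar_direct_sum b Y = scalar_direct_sum (a * b) (X * Y)"
proof -
  have ab: "mat 1 1 (\<lambda>_. a) * mat 1 1 (\<lambda>_. b) = mat 1 1 (\<lambda>_. a * b)"
    by (rule eq_matI) (auto simp: scalar_prod_def)
  show ?thesis
    using assms unfolding scalar_direct_sum_def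
    by (subst mult_four_block_mat[of _ 1 1 _ m _ m _ _ 1 _ m]) (auto simp: ab[unfolded One_nat_def])
qed

lemma mat_adjoint_scalar_direct_sum:
  "X \<in> carrier_mat m m \<Longrightarrow> mat_adjoint (scalar_direct_sum a X) = scalar_direct_sum (conjugate a) (mat_adjoint X)"
  by (rule eq_matI) (auto simp: scalar_direct_sum_def)

lemma scalar_direct_sum_one: "scalar_direct_sum 1 (1\<^sub>m m) = 1\<^sub>m (Suc m)"
  by (rule eq_matI) (auto simp: scalar_direct_sum_def)

lemma mat_diag_Suc: "mat_diag (Suc m) f = scalar_direct_sum (f 0) (mat_diag m (\<lambda>j. f (Suc j)))"
  by (rule eq_matI) (auto simp: scalar_direct_sum_def mat_diag_def)

lemma unitary_mat_scalar_direct_sum: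
  assumes "unitary_mat m U"
  shows "unitary_mat (Suc m) (scalar_direct_sum 1 U)"
  using unitary_matD[OF assms]
  by (simp add: unitary_mat_def scalar_direct_sum_carrier mat_adjoint_scalar_direct_sum scalar_direct_sum_mult[of _ m]
      scalar_direct_sum_one)

lemma hermitian_mat_add:
  assumes A: "A \<in> carrier_mat n n" "hermitian_mat A"
    and B: "B \<in> carrier_mat n n" "hermitian_mat B"
  shows "hermitian_mat (A + B)"
  unfolding hermitian_mat_def
proof (rule eq_matI)
  fix i j assume ij: "i < dim_row (A + B)" "j < dim_col (A + B)"
  then have "mat_adjoint A $$ (i, j) = A $$ (i, j)" "mat_adjoint B $$ (i, j) = B $$ (i, j)"
    using A(2) B(2) by (simp_all add: hermitian_mat_def)
  then show "mat_adjoint (A + B) $$ (i, j) = (A + B) $$ (i, j)"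
    using ij A(1) B(1) by simp
qed (use A B in auto)

text \<open>
Schur's argument. An eigenvector for the first root becomes the first column of a unitary
\<^term>\<open>U\<close>. In the basis given by \<^term>\<open>U\<close> the matrix stays Hermitian, so its first row
vanishes off the diagonal together with its first column, and a Hermitian block of size one less
remains. The list \<^term>\<open>es\<close> of roots fixes the order of the diagonal entries, so a prescribed
ordering of the eigenvalues, repetitions included, is realised by the columns of the unitary factor.
\<close>

theorem hermitian_unitary_diagonalization:
  assumes "M \<in> carrier_mat n n" "hermitian_mat M"
    and "char_poly M = (\<Prod>e\<leftarrow>es. [:- e, 1:])" "length es = n"
  shows "\<exists>U. unitary_mat n U \<and> M = U * mat_diag n (\<lambda>j. es ! j) * mat_adjoint U"
  using assms
proof (induction es arbitrary: n M)
  case Nil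
  then have "M = 1\<^sub>m 0 * mat_diag 0 (\<lambda>j. [] ! j) * mat_adjoint (1\<^sub>m 0)"
    by (intro eq_matI) auto
  moreover have "unitary_mat 0 (1\<^sub>m 0)"
    by (auto simp: unitary_mat_def)
  ultimately show ?case
    using Nil by auto
next
  case (Cons e es n M)
  define m where "m = length es"
  have n: "n = Suc m" using Cons.prems by (simp add: m_def)
  then have n0: "0 < n" by simp
  note M = Cons.prems(1)
  have "eigenvalue M e"
    unfolding eigenvalue_root_char_poly[OF M] Cons.prems(3) by simp
  then obtain v where v: "v \<in> carrier_vec n" "v \<noteq> 0\<^sub>v n" "M *\<^sub>v v = e \<cdot>\<^sub>v v"
    using M by (auto simp: eigenvalue_def eigenvector_def)
  obtain U c where U: "unitary_mat n U" and U0: "col U 0 = c \<cdot>\<^sub>v v"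
    using unitary_with_first_column[OF v(1,2)] by blast
  note UD = unitary_matD[OF U]
  define B where "B = mat_adjoint U * (M * U)"
  have B: "B \<in> carrier_mat n n" using UD M by (auto simp: B_def)
  have adjB: "mat_adjoint B = B"
    using UD M Cons.prems(2) unfolding B_def hermitian_mat_def
    by (simp add: mat_adjoint_mult[of _ n n _ n] assoc_mult_mat[of _ n n _ n _ n])
  have Bsym: "B $$ (i, j) = conjugate (B $$ (j, i))" if "i < n" "j < n" for i j
    using that B arg_cong[OF adjB, of "\<lambda>X. X $$ (i, j)"] by simp
  have "col B 0 = mat_adjoint U *\<^sub>v (M *\<^sub>v col U 0)"
    unfolding B_def col_mult2[OF UD(2) mult_carrier_mat[OF M UD(1)] n0] col_mult2[OF M UD(1) n0] ..
  also have "M *\<^sub>v col U 0 = e \<cdot>\<^sub>v col U 0"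
    using M v by (simp add: U0 mult_mat_vec smult_smult_assoc mult.commute)
  also have "mat_adjoint U *\<^sub>v (e \<cdot>\<^sub>v col U 0) = e \<cdot>\<^sub>v col (mat_adjoint U * U) 0"
    using UD(1,2) n0 by (simp add: mult_mat_vec[of _ n n] col_mult2[of _ n n _ n])
  finally have colB0: "col B 0 = e \<cdot>\<^sub>v col (1\<^sub>m n) 0"
    by (simp only: UD(3))
  have B0: "B $$ (i, 0) = (if i = 0 then e else 0)" if "i < n" for i
    using arg_cong[OF colB0, of "\<lambda>w. w $ i"] that B n0 by simp
  have B0': "B $$ (0, j) = (if j = 0 then e else 0)" if "j < n" for j
    using B0[of j] Bsym[of 0 j] B0[of 0] that n by (cases "j = 0") auto
  define B3 where "B3 = mat m m (\<lambda>(i, j). B $$ (Suc i, Suc j))"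
  let ?e = "mat 1 1 (\<lambda>_. e)"
  have B3: "B3 \<in> carrier_mat m m" by (simp add: B3_def)
  have Bblock: "B = scalar_direct_sum e B3"
    by (rule eq_matI) (use B n B0 B0' in \<open>auto simp: B3_def scalar_direct_sum_def\<close>)
  have "hermitian_mat B3"
    unfolding hermitian_mat_def
  proof (rule eq_matI)
    fix i j assume "i < dim_row B3" "j < dim_col B3"
    then show "mat_adjoint B3 $$ (i, j) = B3 $$ (i, j)"
      using Bsym[of "Suc i" "Suc j"] n by (simp add: B3_def)
  qed (simp_all add: B3_def)
  moreover have "char_poly B3 = (\<Prod>e\<leftarrow>es. [:- e, 1:])"
  proof -
    have MB: "M = U * B * mat_adjoint U"
      using UD M by (simp add: B_def unitary_mult_cancel[OF U] assoc_mult_mat[of _ n n _ n _ n])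
    have "similar_mat_wit M B U (mat_adjoint U)"
      by (rule similar_mat_witI[of _ _ n]) (use UD M B MB in auto)
    then have "char_poly M = char_poly B"
      by (intro char_poly_similar) (auto simp: similar_mat_def)
    also have "\<dots> = char_poly ?e * char_poly B3"
      unfolding Bblock scalar_direct_sum_def
      using char_poly_four_block_zeros_col[OF _ _ B3, of ?e "0\<^sub>m 1 m"] B3 by simp
    also have "char_poly ?e = [:- e, 1:]"
      by (simp add: char_poly_defs det_def sign_def)
    finally have "[:- e, 1:] * char_poly B3 = [:- e, 1:] * (\<Prod>e\<leftarrow>es. [:- e, 1:])"
      using Cons.prems(3) by simp
    then show ?thesis
      by (subst (asm) mult_cancel_left) simp
  qed
  ultimately obtain U3 where U3: "unitary_mat m U3"
    and B3eq: "B3 = U3 * mat_diag m (\<lambda>j. es ! j) * mat_adjoint U3"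
    using Cons.IH[OF B3] m_def by auto
  note U3D = unitary_matD[OF U3]
  let ?W = "scalar_direct_sum 1 U3"
  let ?D = "mat_diag n (\<lambda>j. (e # es) ! j)"
  have W: "unitary_mat n ?W"
    using unitary_mat_scalar_direct_sum[OF U3] by (simp add: n)
  note WD = unitary_matD[OF W]
  have "?W * ?D * mat_adjoint ?W = B"
    unfolding Bblock B3eq n mat_diag_Suc using U3D(1,2)
    by (simp add: mat_adjoint_scalar_direct_sum scalar_direct_sum_mult[of _ m] mult_carrier_mat[of _ m m])
  then have "M = U * (?W * ?D * mat_adjoint ?W) * mat_adjoint U"
    using UD M by (simp add: B_def unitary_mult_cancel[OF U] assoc_mult_mat[of _ n n _ n _ n])
  also have "\<dots> = (U * ?W) * ?D * mat_adjoint (U * ?W)"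
    using UD(1,2) WD(1,2) mat_diag_dim[of n "\<lambda>j. (e # es) ! j"]
    by (simp add: mat_adjoint_mult[OF UD(1) WD(1)] assoc_mult_mat[of _ n n _ n _ n] mult_carrier_mat[of _ n n])
  finally show ?case
    using unitary_mat_mult[OF U W] by blast
qed

section \<open>The matrix 2-norm and the pseudo-inverse\<close>

text \<open>
If \<^term>\<open>v\<close> is an eigenvector of \<^term>\<open>mat_adjoint X * X\<close>, pairing the eigenvalue equation with
\<^term>\<open>v\<close> exhibits the eigenvalue as the quotient of \<^term>\<open>sqnorm (X *\<^sub>v v)\<close> and
\<^term>\<open>sqnorm v\<close>.
\<close>

lemma gram_eigenvalue:
  assumes X: "X \<in> carrier_mat n n" and "eigenvalue (mat_adjoint X * X) e"
  shows "e = complex_of_real (Re e)" "0 \<le> Re e" "sqrt (Re e) \<in> singular_values X"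
proof -
  obtain v where v: "v \<in> carrier_vec n" "v \<noteq> 0\<^sub>v n" "mat_adjoint X * X *\<^sub>v v = e \<cdot>\<^sub>v v"
    using assms by (auto simp: eigenvalue_def eigenvector_def)
  have Xv: "X *\<^sub>v v \<in> carrier_vec n" using X v by auto
  have "e * of_real (sqnorm v) = (mat_adjoint X *\<^sub>v (X *\<^sub>v v)) \<bullet>c v"
    using v X by (simp add: cscalar_prod_self smult_scalar_prod_distrib[of _ n]
        flip: assoc_mult_mat_vec[of _ n n _ n])
  also have "\<dots> = of_real (sqnorm (X *\<^sub>v v))"
    using cscalar_prod_adjoint[OF mat_adjoint_carrier[OF X] Xv v(1)] by (simp add: cscalar_prod_self)
  finally have "e = of_real (sqnorm (X *\<^sub>v v) / sqnorm v)"
    using sqnorm_pos[OF v(1,2)] by (simp add: field_simps)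
  then show real: "e = complex_of_real (Re e)" and nonneg: "0 \<le> Re e"
    by simp_all
  have "complex_of_real ((sqrt (Re e))\<^sup>2) = e"
    using real nonneg by simp
  then show "sqrt (Re e) \<in> singular_values X"
    using assms(2) nonneg by (simp add: singular_values_def del: of_real_power)
qed

text \<open>
The largest singular value is an operator norm: the squared length of \<^term>\<open>X *\<^sub>v x\<close> is the
quadratic form of \<^term>\<open>mat_adjoint X * X\<close>, and in a unitary eigenbasis this is a sum whose weights
are the squared singular values. For \<^term>\<open>n = (0::nat)\<close> there are no singular values and the
maximum is unspecified, hence the positivity assumption on the dimension.
\<close>

lemma norm2_mat_bound:
  assumes X: "X \<in> carrier_mat n n" and n: "0 < n"
  shows "0 \<le> norm2_mat X"
    and "x \<in> carrier_vec n \<Longrightarrow> sqnorm (X *\<^sub>v x) \<le> (norm2_mat X)\<^sup>2 * sqnorm x"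
proof -
  define G where "G = mat_adjoint X * X"
  have G: "G \<in> carrier_mat n n" using X by (simp add: G_def mult_carrier_mat[of _ n n])
  obtain es where es: "char_poly G = (\<Prod>e\<leftarrow>es. [:- e, 1:])" "length es = n"
    using char_poly_factorized[OF G] by blast
  have ev: "eigenvalue G e \<longleftrightarrow> e \<in> set es" for e
    by (auto simp: eigenvalue_root_char_poly[OF G] es(1) poly_prod_list prod_list_zero_iff)
  have "singular_values X \<subseteq> (\<lambda>e. sqrt (Re e)) ` set es"
  proof
    fix \<sigma> assume "\<sigma> \<in> singular_values X"
    then have "\<sigma> = sqrt (Re (complex_of_real (\<sigma>\<^sup>2)))" "complex_of_real (\<sigma>\<^sup>2) \<in> set es"
      using ev[of "complex_of_real (\<sigma>\<^sup>2)"] by (auto simp: singular_values_def G_def)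
    then show "\<sigma> \<in> (\<lambda>e. sqrt (Re e)) ` set es"
      by (rule image_eqI)
  qed
  then have fin: "finite (singular_values X)"
    by (rule finite_subset) simp
  have sv: "es ! j = of_real (Re (es ! j))" "0 \<le> Re (es ! j)" "sqrt (Re (es ! j)) \<le> norm2_mat X"
    if "j < n" for j
    using gram_eigenvalue[OF X, folded G_def, of "es ! j"] that es(2) Max_ge[OF fin]
    by (auto simp: ev norm2_mat_def)
  show "0 \<le> norm2_mat X"
    using sv(2,3)[OF n] by (meson order_trans real_sqrt_ge_zero)
  assume x: "x \<in> carrier_vec n"
  have "hermitian_mat G"
    using X by (simp add: hermitian_mat_def G_def mat_adjoint_mult[of _ n n _ n])
  then obtain U where U: "unitary_mat n U" and Geq: "G = U * mat_diag n (\<lambda>j. es ! j) * mat_adjoint U"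
    using hermitian_unitary_diagonalization[OF G _ es] by blast
  define w where "w = mat_adjoint U *\<^sub>v x"
  have Xx: "X *\<^sub>v x \<in> carrier_vec n" using X x by auto
  have "complex_of_real (sqnorm (X *\<^sub>v x)) = (G *\<^sub>v x) \<bullet>c x"
    using cscalar_prod_adjoint[OF mat_adjoint_carrier[OF X] Xx x] X x
    by (simp add: G_def cscalar_prod_self assoc_mult_mat_vec[of _ n n _ n])
  also have "\<dots> = (\<Sum>j<n. es ! j * of_real ((cmod (w $ j))\<^sup>2))"
    unfolding Geq w_def by (rule quadratic_form_unitary_conj[OF U x])
  also have "\<dots> = (\<Sum>j<n. of_real (Re (es ! j) * (cmod (w $ j))\<^sup>2))"
    by (rule sum.cong) (use sv(1) in \<open>simp_all\<close>)
  finally have "sqnorm (X *\<^sub>v x) = (\<Sum>j<n. Re (es ! j) * (cmod (w $ j))\<^sup>2)"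
    by (simp only: of_real_sum[symmetric] of_real_eq_iff)
  also have "\<dots> \<le> (\<Sum>j<n. (norm2_mat X)\<^sup>2 * (cmod (w $ j))\<^sup>2)"
  proof (intro sum_mono mult_right_mono)
    fix j assume "j \<in> {..<n}"
    then show "Re (es ! j) \<le> (norm2_mat X)\<^sup>2"
      using sv(2,3)[of j] by (simp add: sqrt_le_D)
  qed simp
  also have "\<dots> = (norm2_mat X)\<^sup>2 * sqnorm w"
    using unitary_matD(1)[OF U] by (simp add: sum_distrib_left sqnorm_def w_def)
  finally show "sqnorm (X *\<^sub>v x) \<le> (norm2_mat X)\<^sup>2 * sqnorm x"
    by (simp add: w_def sqnorm_adjoint_unitary[OF U x])
qed

text \<open>
Both \<^term>\<open>X * Y\<close> and \<^term>\<open>X * Z\<close> are Hermitian projections with the same range, hence equal: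
from \<^prop>\<open>X * Y = X * Z * (X * Y)\<close>, taking adjoints swaps the two factors. The same holds for
\<^term>\<open>Y * X\<close> and \<^term>\<open>Z * X\<close>, and then \<^term>\<open>Y * X * Y\<close> and \<^term>\<open>Z * X * Z\<close> agree.
\<close>

lemma moore_penrose_unique:
  assumes Y: "moore_penrose X Y" and Z: "moore_penrose X Z"
  shows "Y = Z"
proof -
  define m n where "m = dim_row X" and "n = dim_col X"
  have X: "X \<in> carrier_mat m n" unfolding m_def n_def by (rule carrier_matI) auto
  have YD: "Y \<in> carrier_mat n m" "X * Y * X = X" "Y * X * Y = Y"
    "mat_adjoint (X * Y) = X * Y" "mat_adjoint (Y * X) = Y * X"
    and ZD: "Z \<in> carrier_mat n m" "X * Z * X = X" "Z * X * Z = Z"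
    "mat_adjoint (X * Z) = X * Z" "mat_adjoint (Z * X) = Z * X"
    using Y Z unfolding moore_penrose_def hermitian_mat_def m_def n_def by blast+
  have XY: "X * Y \<in> carrier_mat m m" and XZ: "X * Z \<in> carrier_mat m m"
    and YX: "Y * X \<in> carrier_mat n n" and ZX: "Z * X \<in> carrier_mat n n"
    using X YD(1) ZD(1) by auto
  have "X * Y = X * Z * (X * Y)"
    using ZD(2) assoc_mult_mat[OF XZ X YD(1)] by simp
  also have "\<dots> = mat_adjoint (X * Y * (X * Z))"
    using mat_adjoint_mult[OF XY XZ] YD(4) ZD(4) by simp
  also have "X * Y * (X * Z) = X * Z"
    using YD(2) assoc_mult_mat[OF XY X ZD(1)] by simp
  finally have range: "X * Y = X * Z"
    using ZD(4) by simp
  have "Y * X = Y * X * (Z * X)"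
    using ZD(2) assoc_mult_mat[OF YD(1) X ZX] assoc_mult_mat[OF X ZD(1) X] by simp
  also have "\<dots> = mat_adjoint (Z * X * (Y * X))"
    using mat_adjoint_mult[OF ZX YX] YD(5) ZD(5) by simp
  also have "Z * X * (Y * X) = Z * X"
    using YD(2) assoc_mult_mat[OF ZD(1) X YX] assoc_mult_mat[OF X YD(1) X] by simp
  finally have corange: "Y * X = Z * X"
    using ZD(5) by simp
  have "Y = Z * X * Y"
    using YD(3) corange by simp
  also have "\<dots> = Z"
    using range ZD(3) assoc_mult_mat[OF ZD(1) X YD(1)] assoc_mult_mat[OF ZD(1) X ZD(1)] by simp
  finally show ?thesis .
qed

lemma unitary_conj_diag_mult:
  assumes V: "unitary_mat n V"
  shows "(V * mat_diag n f * mat_adjoint V) * (V * mat_diag n g * mat_adjoint V) =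
    V * mat_diag n (\<lambda>i. f i * g i) * mat_adjoint V"
proof -
  note VD = unitary_matD[OF V]
  have "mat_diag n f * (mat_diag n g * mat_adjoint V) = mat_diag n (\<lambda>i. f i * g i) * mat_adjoint V"
    using VD(2) by (simp flip: assoc_mult_mat[of _ n n _ n _ n])
  then show ?thesis
    using VD(1,2) mat_diag_dim[of n f] mat_diag_dim[of n g]
    by (simp add: assoc_mult_mat[of _ n n _ n _ n] mult_carrier_mat[of _ n n] unitary_mult_cancel[OF V])
qed

lemma unitary_conj_diag_adjoint:
  assumes V: "unitary_mat n V"
  shows "mat_adjoint (V * mat_diag n f * mat_adjoint V) =
    V * mat_diag n (\<lambda>i. conjugate (f i)) * mat_adjoint V"
  using unitary_matD(1,2)[OF V]
  by (simp add: mat_adjoint_mult[of _ n n _ n] assoc_mult_mat[of _ n n _ n _ n] mult_carrier_mat[of _ n n])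

text \<open>
Here the convention \<^prop>\<open>inverse 0 = (0::complex)\<close> is exactly what the pseudo-inverse does to the
zero eigenvalues of a normal matrix.
\<close>

lemma pinv_unitary_conj_diag:
  assumes V: "unitary_mat n V"
  shows "pinv (V * mat_diag n s * mat_adjoint V) = V * mat_diag n (\<lambda>i. inverse (s i)) * mat_adjoint V"
proof -
  have dims: "V * mat_diag n f * mat_adjoint V \<in> carrier_mat n n" for f
    using unitary_matD(1,2)[OF V] by (auto intro!: mult_carrier_mat[of _ n n])
  have proj: "s i * inverse (s i) = (if s i = 0 then 0 else 1)"
    "inverse (s i) * s i = (if s i = 0 then 0 else 1)" for i
    by auto
  have penrose: "(\<lambda>i. s i * inverse (s i) * s i) = s"
    "(\<lambda>i. inverse (s i) * s i * inverse (s i)) = (\<lambda>i. inverse (s i))"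
    "(\<lambda>i. conjugate (s i * inverse (s i))) = (\<lambda>i. s i * inverse (s i))"
    "(\<lambda>i. conjugate (inverse (s i) * s i)) = (\<lambda>i. inverse (s i) * s i)"
    by (rule ext; simp only: proj; simp)+
  have "moore_penrose (V * mat_diag n s * mat_adjoint V)
      (V * mat_diag n (\<lambda>i. inverse (s i)) * mat_adjoint V)"
    using dims[of s] dims[of "\<lambda>i. inverse (s i)"]
    unfolding moore_penrose_def hermitian_mat_def unitary_conj_diag_mult[OF V] unitary_conj_diag_adjoint[OF V]
      penrose by auto
  then show ?thesis
    unfolding pinv_def by (blast intro: the_equality moore_penrose_unique)
qed

section \<open>The perturbation as a quadratic form on the range\<close>

text \<open>
On the range of \<^term>\<open>S\<close> the pseudo-inverse \<open>T\<close> of \<^term>\<open>S\<close> can be cancelled on both sides: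
\<open>x = T z\<close> with \<open>z = S x\<close>, and \<open>x = T\<^sup>* y\<close> with \<open>y = S\<^sup>* x\<close>. Thus the form of \<^term>\<open>E\<close> at
\<^term>\<open>x\<close> equals the pairing of \<open>T E T z\<close> with \<open>y\<close>, and Cauchy-Schwarz applies. Since \<^term>\<open>S\<close>
is normal, \<open>y\<close> and \<open>z\<close> have the same length, which is the square root of the sum on the right;
the phases of the chosen roots \<^term>\<open>s j\<close> do not affect it.
\<close>

lemma quadratic_form_le_norm2:
  fixes s :: "nat \<Rightarrow> complex" and V :: "complex mat" and n :: nat
  defines "S \<equiv> V * mat_diag n s * mat_adjoint V"
  assumes V: "unitary_mat n V" and n: "0 < n" and E: "E \<in> carrier_mat n n"
    and x: "x \<in> carrier_vec n"
    and supp: "\<And>j. j < n \<Longrightarrow> s j = 0 \<Longrightarrow> (mat_adjoint V *\<^sub>v x) $ j = 0"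
  shows "cmod ((E *\<^sub>v x) \<bullet>c x) \<le>
    norm2_mat (pinv S * E * pinv S) * (\<Sum>j<n. (cmod (s j))\<^sup>2 * (cmod ((mat_adjoint V *\<^sub>v x) $ j))\<^sup>2)"
    (is "_ \<le> norm2_mat ?X * ?q")
proof -
  note VD = unitary_matD[OF V]
  let ?D = "\<lambda>f. V * mat_diag n f * mat_adjoint V"
  have dims: "?D f \<in> carrier_mat n n" for f
    using VD(1,2) by (auto intro!: mult_carrier_mat[of _ n n])
  \<comment> \<open>Both cancellations reduce to this: a diagonal factor that is 1 on the support of the coordinates
  of x fixes x.\<close>
  have fix_x: "?D f *\<^sub>v x = x" if f: "\<And>j. j < n \<Longrightarrow> s j \<noteq> 0 \<Longrightarrow> f j = 1" for f
  proof -
    have "mat_adjoint V *\<^sub>v (?D f *\<^sub>v x) = vec n (\<lambda>j. f j * (mat_adjoint V *\<^sub>v x) $ j)"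
      by (rule adjoint_unitary_conj_mult_vec[OF V x])
    also have "\<dots> = mat_adjoint V *\<^sub>v x"
    proof (rule eq_vecI)
      fix i assume "i < dim_vec (mat_adjoint V *\<^sub>v x)"
      then show "vec n (\<lambda>j. f j * (mat_adjoint V *\<^sub>v x) $ j) $ i = (mat_adjoint V *\<^sub>v x) $ i"
        using supp[of i] f[of i] VD(1) by (cases "s i = 0") auto
    qed (use VD(1) in simp)
    finally have eq: "V *\<^sub>v (mat_adjoint V *\<^sub>v (?D f *\<^sub>v x)) = V *\<^sub>v (mat_adjoint V *\<^sub>v x)"
      by simp
    have VV: "V *\<^sub>v (mat_adjoint V *\<^sub>v y) = y" if "y \<in> carrier_vec n" for y
      using VD that by (simp flip: assoc_mult_mat_vec[of _ n n _ n])
    show ?thesis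
      using eq unfolding VV[OF x] VV[OF mult_mat_vec_carrier[OF dims x]] .
  qed
  define T where "T = ?D (\<lambda>i. inverse (s i))"
  have T: "T \<in> carrier_mat n n" unfolding T_def by (rule dims)
  have S: "S \<in> carrier_mat n n" unfolding S_def by (rule dims)
  have X: "?X = T * E * T"
    by (simp add: S_def T_def pinv_unitary_conj_diag[OF V])
  have Xc: "?X \<in> carrier_mat n n" unfolding X using T E by auto
  define y z where "y = mat_adjoint S *\<^sub>v x" and "z = S *\<^sub>v x"
  have y: "y \<in> carrier_vec n" and z: "z \<in> carrier_vec n"
    using S x unfolding y_def z_def by (auto intro!: mult_mat_vec_carrier[of _ n n])
  have Tz: "T *\<^sub>v z = x"
    unfolding z_def assoc_mult_mat_vec[OF T S x, symmetric]
    unfolding T_def S_def unitary_conj_diag_mult[OF V] by (rule fix_x) simp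
  have Ty: "mat_adjoint T *\<^sub>v y = x"
    unfolding y_def assoc_mult_mat_vec[OF mat_adjoint_carrier[OF T] mat_adjoint_carrier[OF S] x, symmetric]
    unfolding T_def S_def unitary_conj_diag_adjoint[OF V] unitary_conj_diag_mult[OF V]
    by (rule fix_x) simp
  have "?X *\<^sub>v z = T *\<^sub>v (E *\<^sub>v x)"
    unfolding X using T E z Tz by (simp add: assoc_mult_mat_vec[of _ n n _ n] mult_carrier_mat[of _ n n])
  then have "(E *\<^sub>v x) \<bullet>c x = (?X *\<^sub>v z) \<bullet>c y"
    using cscalar_prod_adjoint[OF T mult_mat_vec_carrier[OF E x] y] Ty by simp
  then have "cmod ((E *\<^sub>v x) \<bullet>c x) \<le> sqrt (sqnorm (?X *\<^sub>v z)) * sqrt (sqnorm y)"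
    using cmod_cscalar_prod_le[OF mult_mat_vec_carrier[OF Xc z] y] by simp
  also have "\<dots> \<le> (norm2_mat ?X * sqrt (sqnorm z)) * sqrt (sqnorm y)"
    using real_sqrt_le_mono[OF norm2_mat_bound(2)[OF Xc n z]] norm2_mat_bound(1)[OF Xc n]
    by (intro mult_right_mono) (simp_all add: real_sqrt_mult)
  also have "sqnorm y = ?q"
    unfolding y_def S_def unitary_conj_diag_adjoint[OF V] sqnorm_unitary_conj[OF V x] by simp
  also have "sqnorm z = ?q"
    unfolding z_def S_def by (rule sqnorm_unitary_conj[OF V x])
  finally show ?thesis
    by (simp add: sum_nonneg mult.assoc)
qed

text \<open>
On the range of \<^term>\<open>A\<close> the matrix \<^term>\<open>A + E\<close> lies, as a quadratic form, between
\<open>A - k |A|\<close> and \<open>A + k |A|\<close>, because the squared moduli of the roots \<^term>\<open>s j\<close> are the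
absolute values of the eigenvalues.
\<close>

lemma relative_perturbation_quadratic_form:
  fixes s :: "nat \<Rightarrow> complex" and V :: "complex mat" and n :: nat and d :: "nat \<Rightarrow> real"
  defines "A \<equiv> V * mat_diag n (\<lambda>j. of_real (d j)) * mat_adjoint V"
    and "S \<equiv> V * mat_diag n s * mat_adjoint V"
  assumes V: "unitary_mat n V" and n: "0 < n" and E: "E \<in> carrier_mat n n"
    and s: "\<And>j. j < n \<Longrightarrow> (s j)\<^sup>2 = of_real (d j)"
    and x: "x \<in> carrier_vec n"
    and supp: "\<And>j. j < n \<Longrightarrow> d j = 0 \<Longrightarrow> (mat_adjoint V *\<^sub>v x) $ j = 0"
  defines "k \<equiv> norm2_mat (pinv S * E * pinv S)"
  shows "(\<Sum>j<n. (d j - k * \<bar>d j\<bar>) * (cmod ((mat_adjoint V *\<^sub>v x) $ j))\<^sup>2) \<le> Re (((A + E) *\<^sub>v x) \<bullet>c x)"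
    and "Re (((A + E) *\<^sub>v x) \<bullet>c x) \<le> (\<Sum>j<n. (d j + k * \<bar>d j\<bar>) * (cmod ((mat_adjoint V *\<^sub>v x) $ j))\<^sup>2)"
proof -
  let ?w = "\<lambda>j. (cmod ((mat_adjoint V *\<^sub>v x) $ j))\<^sup>2"
  have s_abs: "(cmod (s j))\<^sup>2 = \<bar>d j\<bar>" if "j < n" for j
    using arg_cong[OF s[OF that], of cmod] by (simp add: norm_power)
  have "cmod ((E *\<^sub>v x) \<bullet>c x) \<le> k * (\<Sum>j<n. (cmod (s j))\<^sup>2 * ?w j)"
    unfolding k_def S_def
    by (rule quadratic_form_le_norm2[OF V n E x]) (use s supp in fastforce)
  also have "\<dots> = k * (\<Sum>j<n. \<bar>d j\<bar> * ?w j)"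
    using s_abs by simp
  finally have "\<bar>Re ((E *\<^sub>v x) \<bullet>c x)\<bar> \<le> k * (\<Sum>j<n. \<bar>d j\<bar> * ?w j)"
    using abs_Re_le_cmod order_trans by blast
  moreover have "Re (((A + E) *\<^sub>v x) \<bullet>c x) = (\<Sum>j<n. d j * ?w j) + Re ((E *\<^sub>v x) \<bullet>c x)"
  proof -
    have A: "A \<in> carrier_mat n n"
      using unitary_matD(1,2)[OF V] by (auto simp: A_def intro!: mult_carrier_mat[of _ n n])
    have "((A + E) *\<^sub>v x) \<bullet>c x = (A *\<^sub>v x) \<bullet>c x + (E *\<^sub>v x) \<bullet>c x"
      using A E x by (simp add: add_mult_distrib_mat_vec[of _ n n] add_scalar_prod_distrib[of _ n])
    also have "(A *\<^sub>v x) \<bullet>c x = of_real (\<Sum>j<n. d j * ?w j)"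
      unfolding A_def quadratic_form_unitary_conj[OF V x] by simp
    finally show ?thesis by simp
  qed
  ultimately show "(\<Sum>j<n. (d j - k * \<bar>d j\<bar>) * ?w j) \<le> Re (((A + E) *\<^sub>v x) \<bullet>c x)"
    and "Re (((A + E) *\<^sub>v x) \<bullet>c x) \<le> (\<Sum>j<n. (d j + k * \<bar>d j\<bar>) * ?w j)"
    by (simp_all add: algebra_simps sum.distrib sum_subtractf sum_distrib_left)
qed

section \<open>Comparing quadratic forms by counting dimensions\<close>

text \<open>
Fewer than \<^term>\<open>n\<close> homogeneous linear equations in \<^term>\<open>n\<close> unknowns: padded with zero rows, the
coefficient matrix is square and singular.
\<close>

lemma exists_nonzero_orthogonal:
  fixes R :: "complex vec set"
  assumes "finite R" "card R < n" "R \<subseteq> carrier_vec n"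
  shows "\<exists>x \<in> carrier_vec n. x \<noteq> 0\<^sub>v n \<and> (\<forall>u \<in> R. u \<bullet> x = 0)"
proof -
  obtain us where us: "set us = R" "length us = card R"
    using assms(1) distinct_card finite_distinct_list by metis
  define r where "r i = (if i < length us then us ! i else 0\<^sub>v n)" for i
  \<comment> \<open>The row with index length us, the first one after the equations, is written as a zero row to fit
  the shape of det_row_0; r supplies zero rows beyond it.\<close>
  define A where "A = mat\<^sub>r n n (\<lambda>i. if i = length us then 0\<^sub>v n else r i)"
  have r: "r i \<in> carrier_vec n" for i
    using assms(3) us(1) by (auto simp: r_def)
  have A: "A \<in> carrier_mat n n" by (simp add: A_def)
  have "det A = 0"
    unfolding A_def by (rule det_row_0) (use r us(2) assms(2) in auto)
  then obtain x where x: "x \<in> carrier_vec n" "x \<noteq> 0\<^sub>v n" "A *\<^sub>v x = 0\<^sub>v n"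
    using det_0_iff_vec_prod_zero[OF A] by blast
  have "us ! i \<bullet> x = 0" if "i < length us" for i
  proof -
    have "i < n" using that us(2) assms(2) by simp
    then have "(A *\<^sub>v x) $ i = us ! i \<bullet> x"
      using that r[of i] A by (simp add: A_def r_def)
    then show ?thesis using x(3) \<open>i < n\<close> by simp
  qed
  then have "\<forall>u\<in>R. u \<bullet> x = 0"
    unfolding us(1)[symmetric] by (auto simp: in_set_conv_nth)
  then show ?thesis
    using x(1,2) by blast
qed

text \<open>
The Courant-Fischer argument. A subspace spanned by \<^term>\<open>card J\<close> columns of one unitary matrix and
one spanned by \<^term>\<open>card K\<close> columns of another share a nonzero vector once the dimensions add up to
more than \<^term>\<open>n\<close>; evaluating the form there relates a lower bound on the first subspace to
an upper bound on the second.
\<close>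

lemma quadratic_form_comparison:
  fixes U V :: "complex mat" and q :: "complex vec \<Rightarrow> real"
  assumes V: "unitary_mat n V" and U: "unitary_mat n U"
    and JK: "J \<subseteq> {..<n}" "K \<subseteq> {..<n}" "n < card J + card K"
    and lower: "\<And>x. x \<in> carrier_vec n \<Longrightarrow> (\<And>j. j \<in> {..<n} - J \<Longrightarrow> (mat_adjoint V *\<^sub>v x) $ j = 0) \<Longrightarrow>
      a * sqnorm x \<le> q x"
    and upper: "\<And>x. x \<in> carrier_vec n \<Longrightarrow> (\<And>j. j \<in> {..<n} - K \<Longrightarrow> (mat_adjoint U *\<^sub>v x) $ j = 0) \<Longrightarrow>
      q x \<le> b * sqnorm x"
  shows "a \<le> b"
proof -
  define R where "R = row (mat_adjoint V) ` ({..<n} - J) \<union> row (mat_adjoint U) ` ({..<n} - K)"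
  have fin: "finite J" "finite K"
    using JK(1,2) by (auto intro: finite_subset)
  have "card R \<le> card ({..<n} - J) + card ({..<n} - K)"
    unfolding R_def by (intro card_Un_le[THEN order_trans] add_mono card_image_le) auto
  also have "\<dots> = (n - card J) + (n - card K)"
    using JK fin by (simp add: card_Diff_subset)
  also have "\<dots> < n"
    using JK card_mono[OF finite_lessThan JK(1)] card_mono[OF finite_lessThan JK(2)] by simp
  finally have "card R < n" .
  moreover have "finite R" "R \<subseteq> carrier_vec n"
    using unitary_matD(1)[OF V] unitary_matD(1)[OF U] by (auto simp: R_def)
  ultimately obtain x where x: "x \<in> carrier_vec n" "x \<noteq> 0\<^sub>v n" "\<And>u. u \<in> R \<Longrightarrow> u \<bullet> x = 0"
    using exists_nonzero_orthogonal by meson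
  have "(mat_adjoint V *\<^sub>v x) $ j = 0" if "j \<in> {..<n} - J" for j
    using x(3)[of "row (mat_adjoint V) j"] that unitary_matD(1)[OF V] by (auto simp: R_def)
  moreover have "(mat_adjoint U *\<^sub>v x) $ j = 0" if "j \<in> {..<n} - K" for j
    using x(3)[of "row (mat_adjoint U) j"] that unitary_matD(1)[OF U] by (auto simp: R_def)
  ultimately have "a * sqnorm x \<le> b * sqnorm x"
    using lower[OF x(1)] upper[OF x(1)] by (meson order_trans)
  then show ?thesis
    using sqnorm_pos[OF x(1,2)] by simp
qed

lemma weighted_sum_bounds:
  assumes V: "unitary_mat n V" and x: "x \<in> carrier_vec n"
    and supp: "\<And>j. j \<in> {..<n} - J \<Longrightarrow> (mat_adjoint V *\<^sub>v x) $ j = 0"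
  shows "(\<And>j. j < n \<Longrightarrow> j \<in> J \<Longrightarrow> a \<le> f j) \<Longrightarrow>
      a * sqnorm x \<le> (\<Sum>j<n. f j * (cmod ((mat_adjoint V *\<^sub>v x) $ j))\<^sup>2)"
    and "(\<And>j. j < n \<Longrightarrow> j \<in> J \<Longrightarrow> f j \<le> a) \<Longrightarrow>
      (\<Sum>j<n. f j * (cmod ((mat_adjoint V *\<^sub>v x) $ j))\<^sup>2) \<le> a * sqnorm x"
proof -
  have eq: "a * sqnorm x = (\<Sum>j<n. a * (cmod ((mat_adjoint V *\<^sub>v x) $ j))\<^sup>2)"
    unfolding sqnorm_adjoint_unitary[OF V x, symmetric]
    using unitary_matD(1)[OF V] by (simp add: sqnorm_def sum_distrib_left)
  show "a * sqnorm x \<le> (\<Sum>j<n. f j * (cmod ((mat_adjoint V *\<^sub>v x) $ j))\<^sup>2)"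
    if f: "\<And>j. j < n \<Longrightarrow> j \<in> J \<Longrightarrow> a \<le> f j"
    unfolding eq
  proof (rule sum_mono)
    fix j assume "j \<in> {..<n}"
    then show "a * (cmod ((mat_adjoint V *\<^sub>v x) $ j))\<^sup>2 \<le> f j * (cmod ((mat_adjoint V *\<^sub>v x) $ j))\<^sup>2"
      using f[of j] supp[of j] by (cases "j \<in> J") (auto intro: mult_right_mono)
  qed
  show "(\<Sum>j<n. f j * (cmod ((mat_adjoint V *\<^sub>v x) $ j))\<^sup>2) \<le> a * sqnorm x"
    if f: "\<And>j. j < n \<Longrightarrow> j \<in> J \<Longrightarrow> f j \<le> a"
    unfolding eq
  proof (rule sum_mono)
    fix j assume "j \<in> {..<n}"
    then show "f j * (cmod ((mat_adjoint V *\<^sub>v x) $ j))\<^sup>2 \<le> a * (cmod ((mat_adjoint V *\<^sub>v x) $ j))\<^sup>2"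
      using f[of j] supp[of j] by (cases "j \<in> J") (auto intro: mult_right_mono)
  qed
qed

section \<open>Counting eigenvalues\<close>

lemma char_poly_unitary_conj_diag:
  assumes V: "unitary_mat n V"
  shows "char_poly (V * mat_diag n d * mat_adjoint V) = (\<Prod>j<n. [:- d j, 1:])"
proof -
  note VD = unitary_matD[OF V]
  have "similar_mat_wit (V * mat_diag n d * mat_adjoint V) (mat_diag n d) V (mat_adjoint V)"
    by (rule similar_mat_witI[of _ _ n]) (use VD in \<open>auto intro!: mult_carrier_mat[of _ n n]\<close>)
  then have "char_poly (V * mat_diag n d * mat_adjoint V) = char_poly (mat_diag n d)"
    by (intro char_poly_similar) (auto simp: similar_mat_def)
  also have "\<dots> = (\<Prod>e\<leftarrow>diag_mat (mat_diag n d). [:- e, 1:])"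
    by (rule char_poly_upper_triangular[OF mat_diag_dim]) (auto simp: mat_diag_def)
  also have "diag_mat (mat_diag n d) = map d [0..<n]"
    by (auto simp: diag_mat_def mat_diag_def)
  finally show ?thesis
    using prod.distinct_set_conv_list[of "[0..<n]" "\<lambda>j. [:- d j, 1:]"]
    by (simp add: comp_def lessThan_atLeast0)
qed

lemma proots_prod_linear:
  fixes c :: "'b \<Rightarrow> 'a :: idom"
  assumes "finite I"
  shows "proots (\<Prod>i\<in>I. [:- c i, 1:]) = image_mset c (mset_set I)"
  using assms
proof (induction I rule: finite_induct)
  case (insert i I)
  have "proots (\<Prod>i\<in>insert i I. [:- c i, 1:]) = proots [:- c i, 1:] + proots (\<Prod>i\<in>I. [:- c i, 1:])"
    unfolding prod.insert[OF insert.hyps] by (rule proots_mult) (auto simp: prod_zero_iff insert.hyps)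
  then show ?case
    using insert by simp
qed simp

text \<open>
The diagonal of an arbitrary unitary diagonalization is a rearrangement of any eigenvalue list.
Matching only the number of entries in a given range avoids choosing a permutation.
\<close>

lemma card_eigenvalues_unitary_conj_diag:
  assumes V: "unitary_mat n V" and lam: "eigenvalue_list n (V * mat_diag n d * mat_adjoint V) lam"
  shows "image_mset d (mset_set {..<n}) = image_mset (\<lambda>i. complex_of_real (lam i)) (mset_set {1..n})"
    and "card {j. j < n \<and> P (d j)} = card {i \<in> {1..n}. P (of_real (lam i))}"
proof -
  have "(\<Prod>j<n. [:- d j, 1:]) = (\<Prod>i=1..n. [:- complex_of_real (lam i), 1:])"
    using lam by (simp add: eigenvalue_list_def char_poly_unitary_conj_diag[OF V])
  then show eq: "image_mset d (mset_set {..<n}) = image_mset (\<lambda>i. complex_of_real (lam i)) (mset_set {1..n})"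
    using proots_prod_linear[of "{..<n}" d] proots_prod_linear[of "{1..n}" "\<lambda>i. complex_of_real (lam i)"]
    by simp
  have "size (filter_mset P (image_mset d (mset_set {..<n}))) = card {j. j < n \<and> P (d j)}"
    by (simp add: filter_mset_image_mset)
  moreover have "size (filter_mset P (image_mset (\<lambda>i. complex_of_real (lam i)) (mset_set {1..n}))) =
      card {i \<in> {1..n}. P (of_real (lam i))}"
    by (simp add: filter_mset_image_mset)
  ultimately show "card {j. j < n \<and> P (d j)} = card {i \<in> {1..n}. P (of_real (lam i))}"
    using eq by simp
qed

section \<open>Relative eigenvalue bounds\<close>

theorem theorem2p1:
  fixes A E S :: "complex mat" and n r :: nat and k :: real
    and lam mu :: "nat \<Rightarrow> real"
  assumes A: "A \<in> carrier_mat n n" "hermitian_mat A"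
    and rank: "vec_space.rank n A = r" "r \<le> n"
    and lam: "eigenvalue_list n A lam"
    and lam_nonzero: "\<forall>i\<in>{1..r}. lam i \<noteq> 0"
    and lam_decreasing: "\<forall>i\<in>{1..r}. \<forall>j\<in>{1..r}. i \<le> j \<longrightarrow> lam i \<ge> lam j"
    and lam_zero: "\<forall>i\<in>{r+1..n}. lam i = 0"
    and E: "E \<in> carrier_mat n n" "hermitian_mat E"
    and mu: "eigenvalue_list n (A + E) mu"
    and mu_decreasing: "\<forall>i\<in>{1..n}. \<forall>j\<in>{1..n}. i \<le> j \<longrightarrow> mu i \<ge> mu j"
    and S: "normal_sqrt n A S"
    and k: "k = norm2_mat (pinv S * E * pinv S)" "k \<le> 1"
  shows "\<forall>i\<in>{1..r}. mu (n - r + i) \<le> lam i + k * \<bar>lam i\<bar> \<and>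
                     mu i \<ge> lam i - k * \<bar>lam i\<bar>"
proof
  fix i assume i: "i \<in> {1..r}"
  then have n: "0 < n" using rank(2) by simp
  \<comment> \<open>The diagonalization that comes with the square root need not list the eigenvalues in order, so
  subspaces are selected below by the values d0 j rather than by their positions.\<close>
  obtain V d0 s where V: "unitary_mat n V" and Adiag: "A = V * mat_diag n d0 * mat_adjoint V"
    and Sdiag: "S = V * mat_diag n s * mat_adjoint V" and s0: "\<And>j. j < n \<Longrightarrow> (s j)\<^sup>2 = d0 j"
    using S by (auto simp: normal_sqrt_def)
  define d where "d j = Re (d0 j)" for j
  note eigs = card_eigenvalues_unitary_conj_diag[OF V lam[unfolded Adiag]]
  have d0: "d0 j = of_real (d j)" if "j < n" for j
  proof -
    have "d0 j \<in># image_mset d0 (mset_set {..<n})"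
      using that by simp
    then show ?thesis
      unfolding eigs(1) d_def by auto
  qed
  have "mat_diag n d0 = mat_diag n (\<lambda>j. of_real (d j))"
    by (rule eq_matI) (auto simp: mat_diag_def d0)
  then have Ad: "A = V * mat_diag n (\<lambda>j. of_real (d j)) * mat_adjoint V"
    by (simp add: Adiag)
  have s: "(s j)\<^sup>2 = of_real (d j)" if "j < n" for j
    using s0 d0 that by simp

  \<comment> \<open>For A + E the spectral theorem provides eigenvectors in the order of mu; its 0-based index j
  corresponds to the eigenvalue with number Suc j.\<close>
  define es where "es = map (\<lambda>j. complex_of_real (mu (Suc j))) [0..<n]"
  have AE: "A + E \<in> carrier_mat n n" using A E by simp
  have "hermitian_mat (A + E)"
    by (rule hermitian_mat_add[OF A E])
  moreover have "char_poly (A + E) = (\<Prod>e\<leftarrow>es. [:- e, 1:])"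
    using mu prod.distinct_set_conv_list[of "[0..<n]" "\<lambda>j. [:- complex_of_real (mu (Suc j)), 1:]"]
    by (simp add: eigenvalue_list_def es_def comp_def prod.atLeast1_atMost_eq lessThan_atLeast0)
  ultimately obtain U where U: "unitary_mat n U"
    and AEdiag: "A + E = U * mat_diag n (\<lambda>j. es ! j) * mat_adjoint U"
    using hermitian_unitary_diagonalization[OF AE, of es] by (auto simp: es_def)
  define q where "q x = Re (((A + E) *\<^sub>v x) \<bullet>c x)" for x
  have q_mu: "q x = (\<Sum>j<n. mu (Suc j) * (cmod ((mat_adjoint U *\<^sub>v x) $ j))\<^sup>2)"
    if x: "x \<in> carrier_vec n" for x
    unfolding q_def AEdiag quadratic_form_unitary_conj[OF U x] by (simp add: es_def)

  have X: "pinv S * E * pinv S \<in> carrier_mat n n"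
    using unitary_matD(1,2)[OF V] E(1) unfolding Sdiag pinv_unitary_conj_diag[OF V]
    by (auto intro!: mult_carrier_mat[of _ n n])
  have k0: "0 \<le> k"
    unfolding k(1) by (rule norm2_mat_bound(1)[OF X n])
  \<comment> \<open>With k at most 1 the shifts keep the eigenvalues of A in order, so the extreme value over an
  initial or final segment of them is attained at its end point.\<close>
  have mono_minus: "a - k * \<bar>a\<bar> \<le> b - k * \<bar>b\<bar>" and mono_plus: "a + k * \<bar>a\<bar> \<le> b + k * \<bar>b\<bar>"
    if "a \<le> b" for a b
  proof -
    have "k * \<bar>\<bar>b\<bar> - \<bar>a\<bar>\<bar> \<le> 1 * (b - a)"
      using that k0 k(2) by (intro mult_mono) auto
    then have "\<bar>k * \<bar>b\<bar> - k * \<bar>a\<bar>\<bar> \<le> b - a"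
      using k0 by (simp add: abs_mult flip: right_diff_distrib)
    then show "a - k * \<bar>a\<bar> \<le> b - k * \<bar>b\<bar>" "a + k * \<bar>a\<bar> \<le> b + k * \<bar>b\<bar>"
      by linarith+
  qed
  have form_bounds: "(\<Sum>j<n. (d j - k * \<bar>d j\<bar>) * (cmod ((mat_adjoint V *\<^sub>v x) $ j))\<^sup>2) \<le> q x"
      "q x \<le> (\<Sum>j<n. (d j + k * \<bar>d j\<bar>) * (cmod ((mat_adjoint V *\<^sub>v x) $ j))\<^sup>2)"
    if "x \<in> carrier_vec n" "\<And>j. j < n \<Longrightarrow> d j = 0 \<Longrightarrow> (mat_adjoint V *\<^sub>v x) $ j = 0" for x
    using relative_perturbation_quadratic_form[OF V n E(1), of s d x] s that
    unfolding q_def k(1) Sdiag Ad by blast+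

  have "mu i \<ge> lam i - k * \<bar>lam i\<bar>"
  proof (rule quadratic_form_comparison[OF V U])
    \<comment> \<open>At least i eigenvectors of A with nonzero eigenvalue at least lam i, against the n - i + 1
    eigenvectors of A + E numbered i, ..., n.\<close>
    define J where "J = {j. j < n \<and> d0 j \<noteq> 0 \<and> lam i \<le> Re (d0 j)}"
    define K where "K = {i - 1..<n}"
    show "J \<subseteq> {..<n}" "K \<subseteq> {..<n}"
      by (auto simp: J_def K_def)
    have "card J = card {t \<in> {1..n}. complex_of_real (lam t) \<noteq> 0 \<and> lam i \<le> Re (of_real (lam t))}"
      unfolding J_def by (rule eigs(2))
    also have "\<dots> \<ge> card {1..i}"
      by (rule card_mono) (use i rank(2) lam_nonzero lam_decreasing in auto)
    finally have "i \<le> card J" by simp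
    then show "n < card J + card K"
      using i rank(2) by (simp add: K_def)
    fix x :: "complex vec" assume x: "x \<in> carrier_vec n"
    show "(lam i - k * \<bar>lam i\<bar>) * sqnorm x \<le> q x"
      if supp: "\<And>j. j \<in> {..<n} - J \<Longrightarrow> (mat_adjoint V *\<^sub>v x) $ j = 0"
    proof -
      have "(lam i - k * \<bar>lam i\<bar>) * sqnorm x \<le>
          (\<Sum>j<n. (d j - k * \<bar>d j\<bar>) * (cmod ((mat_adjoint V *\<^sub>v x) $ j))\<^sup>2)"
        by (rule weighted_sum_bounds(1)[OF V x, of J]) (use supp in \<open>auto simp: J_def d_def intro: mono_minus\<close>)
      also have "\<dots> \<le> q x"
        by (rule form_bounds(1)[OF x]) (use supp d0 in \<open>auto simp: J_def\<close>)
      finally show ?thesis .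
    qed
    show "q x \<le> mu i * sqnorm x"
      if supp: "\<And>j. j \<in> {..<n} - K \<Longrightarrow> (mat_adjoint U *\<^sub>v x) $ j = 0"
      unfolding q_mu[OF x]
      by (rule weighted_sum_bounds(2)[OF U x, of K]) (use supp i rank(2) mu_decreasing in \<open>auto simp: K_def\<close>)
  qed
  moreover have "mu (n - r + i) \<le> lam i + k * \<bar>lam i\<bar>"
  proof (rule quadratic_form_comparison[OF U V])
    \<comment> \<open>At least r - i + 1 eigenvectors of A with nonzero eigenvalue at most lam i, against the n - r + i
    eigenvectors of A + E numbered 1, ..., n - r + i.\<close>
    define J where "J = {j. j < n \<and> d0 j \<noteq> 0 \<and> Re (d0 j) \<le> lam i}"
    define K where "K = {..<n - r + i}"
    show "K \<subseteq> {..<n}" "J \<subseteq> {..<n}"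
      using i rank(2) by (auto simp: J_def K_def)
    have "card J = card {t \<in> {1..n}. complex_of_real (lam t) \<noteq> 0 \<and> Re (of_real (lam t)) \<le> lam i}"
      unfolding J_def by (rule eigs(2))
    also have "\<dots> \<ge> card {i..r}"
      by (rule card_mono) (use i rank(2) lam_nonzero lam_decreasing in auto)
    finally have "Suc r - i \<le> card J" by simp
    then show "n < card K + card J"
      using i rank(2) by (simp add: K_def)
    fix x :: "complex vec" assume x: "x \<in> carrier_vec n"
    show "q x \<le> (lam i + k * \<bar>lam i\<bar>) * sqnorm x"
      if supp: "\<And>j. j \<in> {..<n} - J \<Longrightarrow> (mat_adjoint V *\<^sub>v x) $ j = 0"
    proof -
      have "q x \<le> (\<Sum>j<n. (d j + k * \<bar>d j\<bar>) * (cmod ((mat_adjoint V *\<^sub>v x) $ j))\<^sup>2)"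
        by (rule form_bounds(2)[OF x]) (use supp d0 in \<open>auto simp: J_def\<close>)
      also have "\<dots> \<le> (lam i + k * \<bar>lam i\<bar>) * sqnorm x"
        by (rule weighted_sum_bounds(2)[OF V x, of J]) (use supp in \<open>auto simp: J_def d_def intro: mono_plus\<close>)
      finally show ?thesis .
    qed
    show "mu (n - r + i) * sqnorm x \<le> q x"
      if supp: "\<And>j. j \<in> {..<n} - K \<Longrightarrow> (mat_adjoint U *\<^sub>v x) $ j = 0"
      unfolding q_mu[OF x]
      by (rule weighted_sum_bounds(1)[OF U x, of K]) (use supp i rank(2) mu_decreasing in \<open>auto simp: K_def\<close>)
  qed
  ultimately show "mu (n - r + i) \<le> lam i + k * \<bar>lam i\<bar> \<and> mu i \<ge> lam i - k * \<bar>lam i\<bar>"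
    by simp
qed

end
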